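(* Let $F$ be the function on the tangent bundle $T(\mathfrak{T}_1)$ of $\mathfrak{T}_1$ given by $$(A_1,A_2,A_3,v_1,v_2,v_3)\mapsto\max_{i}\left\{\frac{v_i}{A_i}\right\},$$ where $(A_1,A_2,A_3)\in\mathfrak{T}_1$ and $(v_1,v_2,v_3)$ is a tangent vector to $\mathfrak{T}_1$ at that point. Then $F$ is a Finsler structure on $\mathfrak{T}_1$, and the metric $\eta$ is induced by $F$; that is, for all $X,Y\in\mathfrak{T}_1$, $$\eta(X,Y)=\inf_c\int_0^1F(\dot c(t))\,dt,$$ where $c$ ranges over all piecewise $C^1$ curves $c:[0,1]\to\mathfrak{T}_1$ with $c(0)=X$ and $c(1)=Y$.
   Context: $\mathbb{R}_+^*$ denotes the set of positive reals. $\mathfrak{T}_1=\{(A_1,A_2,A_3)\in(\mathbb{R}_+^* )^3:(A_1+A_2+A_3)A_1A_2A_3=1\}$ (the space of marked unit area Euclidean triangles), an embedded differentiable submanifold of $(\mathbb{R}_+^* )^3$, whose tangent vectors are regarded as vectors $(v_1,v_2,v_3)\in\mathbb{R}^3$. The metric $\eta$ on $\mathfrak{T}_1$ (not symmetric) is $\eta((A_1,A_2,A_3),(A_1',A_2',A_3'))=\log\max\{A_1'/A_1,A_2'/A_2,A_3'/A_3\}$. A Minkowski norm on a real vector space $V$ is a function $\|\cdot\|:V\to[0,\infty)$ such that for all $v,w\in V$: $\|v\|=0$ iff $v=0$; $\|tv\|=t\|v\|$ for $t>0$; and $\|tv+(1-t)w\|\le t\|v\|+(1-t)\|w\|$ for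 $t\in[0,1]$ (no symmetry is required). A Finsler structure on a differentiable manifold $M$ is a continuous function $F:TM\to[0,\infty)$ whose restriction to each tangent space $T_xM$ is a Minkowski norm. *)

theory Defs
  imports "HOL-Analysis.Analysis"
begin

section \<open>Embedded submanifolds of a Euclidean space\<close>

definition C1_map_on :: "'a::euclidean_space set \<Rightarrow> ('a \<Rightarrow> 'b::euclidean_space) \<Rightarrow> bool" where
  "C1_map_on U f \<longleftrightarrow>
     (\<exists>f' :: 'a \<Rightarrow> 'a \<Rightarrow>\<^sub>L 'b.
        (\<forall>x\<in>U. (f has_derivative blinfun_apply (f' x)) (at x)) \<and> continuous_on U f')"

text \<open>Every point has a neighbourhood that a \<open>C\<^sup>1\<close> diffeomorphism between open sets straightens;
  the model space \<open>S\<close> is the same at all points, so the dimension is constant.\<close>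

definition embedded_C1_submanifold :: "'a::euclidean_space set \<Rightarrow> bool" where
  "embedded_C1_submanifold M \<longleftrightarrow>
     (\<exists>S. subspace S \<and>
       (\<forall>p\<in>M. \<exists>U V (\<phi> :: 'a \<Rightarrow> 'a) \<psi>.
          open U \<and> p \<in> U \<and> open V \<and> homeomorphism U V \<phi> \<psi> \<and>
          C1_map_on U \<phi> \<and> C1_map_on V \<psi> \<and> \<phi> ` (M \<inter> U) = S \<inter> V))"

text \<open>Tangent vectors are the velocities at time \<open>0\<close> of \<open>C\<^sup>1\<close> curves in \<open>M\<close>.\<close>

definition tangent_space :: "'a::euclidean_space set \<Rightarrow> 'a \<Rightarrow> 'a set" where
  "tangent_space M x =
     {v. \<exists>c e. 0 < e \<and> c C1_differentiable_on {-e<..<e} \<and> c ` {-e<..<e} \<subseteq> M \<and>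
           c 0 = x \<and> (c has_vector_derivative v) (at (0::real))}"

text \<open>For an embedded submanifold the topology of the tangent bundle is the one induced by
  the ambient product space.\<close>

definition tangent_bundle :: "'a::euclidean_space set \<Rightarrow> ('a \<times> 'a) set" where
  "tangent_bundle M = (SIGMA x:M. tangent_space M x)"


section \<open>Finsler structures (not assumed symmetric)\<close>

definition minkowski_norm_on :: "'a::real_vector set \<Rightarrow> ('a \<Rightarrow> real) \<Rightarrow> bool" where
  "minkowski_norm_on V N \<longleftrightarrow>
     subspace V \<and>
     (\<forall>v\<in>V. 0 \<le> N v) \<and>
     (\<forall>v\<in>V. N v = 0 \<longleftrightarrow> v = 0) \<and>
     (\<forall>v\<in>V. \<forall>t>0. N (t *\<^sub>R v) = t * N v) \<and>
     (\<forall>v\<in>V. \<forall>w\<in>V. \<forall>t\<in>{0..1}.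
        N (t *\<^sub>R v + (1 - t) *\<^sub>R w) \<le> t * N v + (1 - t) * N w)"

text \<open>Only the values of \<open>F\<close> on the tangent bundle of \<open>M\<close> matter.\<close>

definition finsler_structure_on ::
    "'a::euclidean_space set \<Rightarrow> ('a \<times> 'a \<Rightarrow> real) \<Rightarrow> bool" where
  "finsler_structure_on M F \<longleftrightarrow>
     embedded_C1_submanifold M \<and>
     continuous_on (tangent_bundle M) F \<and>
     (\<forall>x\<in>M. minkowski_norm_on (tangent_space M x) (\<lambda>v. F (x, v)))"

text \<open>The curve is \<open>C\<^sup>1\<close> up to the endpoints of each closed piece. The library predicate
  \<open>piecewise_C1_differentiable_on\<close> is weaker: it admits unbounded derivatives near a
  breakpoint, for which the length integral can fail to exist.\<close>

definition piecewise_C1_curve :: "(real \<Rightarrow> 'a::real_normed_vector) \<Rightarrow> bool" where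
  "piecewise_C1_curve c \<longleftrightarrow>
     (\<exists>(n::nat) p. p 0 = 0 \<and> p n = 1 \<and>
       (\<forall>i<n. p i < p (Suc i) \<and>
         (\<exists>D. continuous_on {p i..p (Suc i)} D \<and>
            (\<forall>t\<in>{p i..p (Suc i)}.
               (c has_vector_derivative D t) (at t within {p i..p (Suc i)})))))"

definition curves_between ::
    "'a::euclidean_space set \<Rightarrow> 'a \<Rightarrow> 'a \<Rightarrow> (real \<Rightarrow> 'a) set" where
  "curves_between M x y =
     {c. piecewise_C1_curve c \<and> c ` {0..1} \<subseteq> M \<and> c 0 = x \<and> c 1 = y}"

text \<open>The velocity is unspecified at the finitely many corners, which do not affect the
  integral.\<close>

definition finsler_length :: "('a::euclidean_space \<times> 'a \<Rightarrow> real) \<Rightarrow> (real \<Rightarrow> 'a) \<Rightarrow> real" where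
  "finsler_length F c =
     integral {0..1} (\<lambda>t. F (c t, vector_derivative c (at t within {0..1})))"

text \<open>The infimum is taken in \<open>ereal\<close> so that it is the genuine one (over an empty or
  unbounded set of lengths, the infimum in \<open>real\<close> is an arbitrary value).\<close>

definition induced_by_finsler ::
    "'a::euclidean_space set \<Rightarrow> ('a \<times> 'a \<Rightarrow> real) \<Rightarrow> ('a \<Rightarrow> 'a \<Rightarrow> real) \<Rightarrow> bool" where
  "induced_by_finsler M F d \<longleftrightarrow>
     (\<forall>x\<in>M. \<forall>y\<in>M. ereal (d x y) = (INF c\<in>curves_between M x y. ereal (finsler_length F c)))"


section \<open>Marked unit area Euclidean triangles\<close>

definition T1_space :: "(real ^ 3) set" where
  "T1_space =
     {A. 0 < A $ 1 \<and> 0 < A $ 2 \<and> 0 < A $ 3 \<and>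
         (A $ 1 + A $ 2 + A $ 3) * A $ 1 * A $ 2 * A $ 3 = 1}"

definition eta :: "real ^ 3 \<Rightarrow> real ^ 3 \<Rightarrow> real" where
  "eta A A' = ln (Max {A' $ 1 / A $ 1, A' $ 2 / A $ 2, A' $ 3 / A $ 3})"

definition F_T1 :: "(real ^ 3) \<times> (real ^ 3) \<Rightarrow> real" where
  "F_T1 = (\<lambda>(A, v). Max {v $ 1 / A $ 1, v $ 2 / A $ 2, v $ 3 / A $ 3})"

end

theory Submission
  imports Defs
begin

text \<open>
  The map \<open>A \<mapsto> (ln A\<^sub>i + ln (A\<^sub>1 + A\<^sub>2 + A\<^sub>3) / 3)\<^sub>i\<close> is a diffeomorphism of the positive octant onto
  the whole space. Its coordinates sum to the logarithm of \<open>(A\<^sub>1 + A\<^sub>2 + A\<^sub>3) A\<^sub>1 A\<^sub>2 A\<^sub>3\<close>, so it maps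
  the unit area triangles onto the plane of vectors with coordinate sum \<open>0\<close>.

  Along any curve \<open>c\<close> the length density dominates each logarithmic derivative \<open>c\<^sub>i' / c\<^sub>i\<close>, which
  gives \<open>\<eta> \<le>\<close> length. Equality holds for straight lines in the chart: there
  \<open>ln c\<^sub>i(t) = x\<^sub>i + t u\<^sub>i - h(t)\<close> with \<open>h\<close> independent of \<open>i\<close>, so the same index maximises
  \<open>c\<^sub>i' / c\<^sub>i\<close> at all times.
\<close>

section \<open>Derivatives of vector-valued maps and maxima over three indices\<close>

lemma C1_map_onI:
  fixes f :: "'a::euclidean_space \<Rightarrow> 'b::euclidean_space"
  assumes deriv: "\<And>x. x \<in> U \<Longrightarrow> (f has_derivative D x) (at x)"
    and cont: "\<And>v. continuous_on U (\<lambda>x. D x v)"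
  shows "C1_map_on U f"
  unfolding C1_map_on_def
proof (intro exI conjI ballI)
  \<comment> \<open>\<open>Blinfun\<close> is meaningful only for bounded linear maps; on
    \<open>U\<close> boundedness comes from \<open>D x\<close> being a derivative.\<close>
  have blinfun: "blinfun_apply (Blinfun (D x)) = D x" if "x \<in> U" for x
    using deriv[OF that] by (simp add: bounded_linear_Blinfun_apply has_derivative_bounded_linear)
  show "(f has_derivative blinfun_apply (Blinfun (D x))) (at x)" if "x \<in> U" for x
    using deriv[OF that] blinfun[OF that] by simp
  have "continuous_on U (\<lambda>x. blinfun_apply (Blinfun (D x)) i)" for i
    using cont[of i] by (rule continuous_on_eq) (simp add: blinfun)
  \<comment> \<open>In finite dimension, continuity of the values on basis vectors already gives
    continuity in the operator norm.\<close>
  then show "continuous_on U (\<lambda>x. Blinfun (D x))"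
    by (intro continuous_on_blinfun_componentwise) auto
qed

lemma has_derivative_vec:
  fixes f :: "'a::real_normed_vector \<Rightarrow> 'n::finite \<Rightarrow> real"
  assumes "\<And>i. ((\<lambda>x. f x i) has_derivative (\<lambda>v. f' v i)) (at a within S)"
  shows "((\<lambda>x. \<chi> i. f x i) has_derivative (\<lambda>v. \<chi> i. f' v i)) (at a within S)"
  using assms by (subst has_derivative_componentwise_within) (auto simp: Basis_vec_def inner_axis)

text \<open>Turns the three-element maxima in \<open>F_T1\<close> and \<open>eta\<close> into maxima
  over the index type, so that the three coordinates are handled uniformly.\<close>

lemma Max_range_3:
  fixes f :: "3 \<Rightarrow> 'a::linorder"
  shows "Max (range f) = Max {f 1, f 2, f 3}"
  by (simp add: UNIV_3)

lemma F_T1_altdef: "F_T1 (A, v) = Max (range (\<lambda>i. v $ i / A $ i))"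
  by (simp add: F_T1_def Max_range_3)

lemma Max_range_add_const:
  fixes f :: "'n::finite \<Rightarrow> real"
  shows "Max (range (\<lambda>i. f i + c)) = Max (range f) + c"
  using Max_add_commute[of UNIV f c] by simp

section \<open>The logarithmic chart, its inverse and their derivatives\<close>

definition octant :: "(real ^ 3) set" where
  "octant = {A. \<forall>i. 0 < A $ i}"

definition chart :: "real ^ 3 \<Rightarrow> real ^ 3" where
  "chart A = (\<chi> i. ln (A $ i) + ln (\<Sum>j\<in>UNIV. A $ j) / 3)"

text \<open>If \<open>x = chart A\<close> and \<open>s\<close> is the coordinate sum of
  \<open>A\<close>, then the numbers \<open>exp (x $ j)\<close> add up to
  \<open>s powr (4/3)\<close>. Hence \<open>ln s / 3\<close> is recovered from \<open>x\<close> as a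
  quarter of the logarithm of that sum, which explains the factor 4.\<close>

definition unchart :: "real ^ 3 \<Rightarrow> real ^ 3" where
  "unchart x = (\<chi> i. exp (x $ i - ln (\<Sum>j\<in>UNIV. exp (x $ j)) / 4))"

definition dchart :: "real ^ 3 \<Rightarrow> real ^ 3 \<Rightarrow> real ^ 3" where
  "dchart A v = (\<chi> i. v $ i / A $ i + (\<Sum>j\<in>UNIV. v $ j) / (3 * (\<Sum>j\<in>UNIV. A $ j)))"

text \<open>The subtracted term does not depend on \<open>i\<close>: relative to
  \<open>unchart x $ i\<close>, each component is \<open>u $ i\<close> up to a common shift. The
  speed of straight chart lines is computed from this.\<close>

definition dunchart :: "real ^ 3 \<Rightarrow> real ^ 3 \<Rightarrow> real ^ 3" where
  "dunchart x u = (\<chi> i. unchart x $ i *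
     (u $ i - (\<Sum>j\<in>UNIV. exp (x $ j) * u $ j) / (4 * (\<Sum>j\<in>UNIV. exp (x $ j)))))"

lemma sum_octant_pos: "A \<in> octant \<Longrightarrow> 0 < (\<Sum>j\<in>UNIV. A $ j)"
  by (simp add: octant_def sum_pos)

lemma octant_nonzero: "A \<in> octant \<Longrightarrow> A $ i \<noteq> 0"
  by (metis (mono_tags) less_irrefl mem_Collect_eq octant_def)

lemma sum_exp_pos: "0 < (\<Sum>j\<in>UNIV. exp (x $ j))" for x :: "real ^ 3"
  by (simp add: sum_pos)

lemma open_octant: "open octant"
proof -
  have "octant = (\<Inter>i. {A. 0 < A $ i})"
    by (auto simp: octant_def)
  also have "open \<dots>"
    by (intro open_INT ballI open_Collect_less continuous_intros) auto
  finally show ?thesis .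
qed

lemma unchart_octant: "unchart x \<in> octant"
  by (simp add: octant_def unchart_def)

lemma unchart_chart:
  assumes "A \<in> octant"
  shows "unchart (chart A) = A"
proof -
  define s where "s = (\<Sum>j\<in>UNIV. A $ j)"
  have s: "0 < s" and A: "\<And>i. 0 < A $ i"
    using sum_octant_pos assms by (auto simp: octant_def s_def)
  have "exp (chart A $ i) = A $ i * exp (ln s / 3)" for i
    using A[of i] by (simp add: chart_def exp_add s_def)
  then have "(\<Sum>j\<in>UNIV. exp (chart A $ j)) = s * exp (ln s / 3)"
    by (simp add: s_def sum_distrib_right)
  then have "ln (\<Sum>j\<in>UNIV. exp (chart A $ j)) / 4 = ln s / 3"
    using s by (simp add: ln_mult)
  then have "chart A $ i - ln (\<Sum>j\<in>UNIV. exp (chart A $ j)) / 4 = ln (A $ i)" for i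
    unfolding chart_def by (simp add: s_def)
  then show ?thesis
    using A by (simp add: vec_eq_iff unchart_def)
qed

lemma chart_unchart: "chart (unchart x) = x"
proof -
  define s where "s = (\<Sum>j\<in>UNIV. exp (x $ j))"
  have s: "0 < s"
    using sum_exp_pos by (simp add: s_def)
  \<comment> \<open>The sum is \<open>s powr (3/4)\<close>, so the correction added by
    \<open>chart\<close> is \<open>ln s / 4\<close>, exactly what \<open>unchart\<close>
    subtracts.\<close>
  have "(\<Sum>j\<in>UNIV. unchart x $ j) = s * exp (- ln s / 4)"
    by (simp add: unchart_def s_def sum_distrib_right flip: exp_add)
  then have "ln (\<Sum>j\<in>UNIV. unchart x $ j) / 3 = ln s / 4"
    using s by (simp add: ln_mult)
  then show ?thesis
    by (simp add: chart_def vec_eq_iff) (simp add: unchart_def s_def)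
qed

text \<open>The shared term \<open>ln s / 3\<close> occurs three times, so the coordinate sum is the
  logarithm of the product that the area condition sets to 1. The chart thus makes this condition
  linear. Membership in the octant is stated separately because \<open>chart\<close> is a total
  function.\<close>

lemma T1_space_iff: "A \<in> T1_space \<longleftrightarrow> A \<in> octant \<and> (\<Sum>i\<in>UNIV. chart A $ i) = 0"
proof (cases "A \<in> octant")
  case True
  define g where "g = (\<Sum>i\<in>UNIV. A $ i) * A $ 1 * A $ 2 * A $ 3"
  have pos: "0 < A $ i" "0 < (\<Sum>i\<in>UNIV. A $ i)" for i
    using True sum_octant_pos by (auto simp: octant_def)
  then have "0 < g"
    by (simp add: g_def)
  have "ln g = ln (\<Sum>i\<in>UNIV. A $ i) + ln (A $ 1) + ln (A $ 2) + ln (A $ 3)"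
    unfolding g_def using pos by (simp add: ln_mult_pos)
  then have "(\<Sum>i\<in>UNIV. chart A $ i) = ln g"
    by (simp add: chart_def sum.distrib) (simp add: sum_3)
  moreover have "A \<in> T1_space \<longleftrightarrow> g = 1"
    using pos by (simp add: T1_space_def g_def sum_3)
  ultimately show ?thesis
    using True \<open>0 < g\<close> by simp
next
  case False
  then show ?thesis
    by (auto simp: T1_space_def octant_def forall_3)
qed

lemma unchart_T1: "(\<Sum>i\<in>UNIV. x $ i) = 0 \<Longrightarrow> unchart x \<in> T1_space"
  by (simp add: T1_space_iff unchart_octant chart_unchart)

lemma has_derivative_chart:
  assumes "A \<in> octant"
  shows "(chart has_derivative dchart A) (at A)"
proof -
  have pos: "0 < A $ i" "0 < (\<Sum>i\<in>UNIV. A $ i)" for i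
    using assms sum_octant_pos by (auto simp: octant_def)
  show ?thesis
    unfolding chart_def dchart_def
    by (rule has_derivative_vec)
      (use pos in \<open>auto intro!: derivative_eq_intros
        bounded_linear.has_derivative[OF bounded_linear_vec_nth] simp: fun_eq_iff divide_simps\<close>)
qed

lemma has_derivative_unchart: "(unchart has_derivative dunchart x) (at x)"
  unfolding unchart_def dunchart_def
  by (rule has_derivative_vec)
    (use sum_exp_pos[of x] in \<open>auto intro!: derivative_eq_intros
      bounded_linear.has_derivative[OF bounded_linear_vec_nth]
      simp: fun_eq_iff divide_simps mult_ac\<close>)

lemma continuous_on_unchart: "continuous_on S unchart"
  by (auto intro!: continuous_at_imp_continuous_on
      intro: has_derivative_continuous has_derivative_unchart)

lemma continuous_on_dchart: "continuous_on octant (\<lambda>A. dchart A v)"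
  unfolding dchart_def
  using sum_octant_pos[THEN less_imp_neq]
  by (intro continuous_intros) (auto simp: octant_nonzero)

lemma continuous_on_dunchart: "continuous_on S (\<lambda>x. dunchart x u)"
  unfolding dunchart_def
  using sum_exp_pos[THEN less_imp_neq]
  by (intro continuous_intros continuous_on_unchart) (metis mult_eq_0_iff zero_neq_numeral)

text \<open>The chain rule for \<open>unchart \<circ> chart\<close>, which is the identity on the
  open octant, replaces a computation with the explicit formulas.\<close>

lemma dunchart_dchart:
  assumes "A \<in> octant"
  shows "dunchart (chart A) (dchart A v) = v"
proof -
  have "(unchart \<circ> chart has_derivative dunchart (chart A) \<circ> dchart A) (at A)"
    using has_derivative_chart[OF assms] has_derivative_unchart by (rule diff_chain_at)
  moreover have "(unchart \<circ> chart has_derivative id) (at A)"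
    using has_derivative_id open_octant assms
    by (rule has_derivative_transform_within_open) (simp add: unchart_chart)
  ultimately have "dunchart (chart A) \<circ> dchart A = id"
    by (rule has_derivative_unique)
  then show ?thesis
    by (simp add: fun_eq_iff)
qed

section \<open>Submanifold structure and tangent spaces\<close>

lemma embedded_T1: "embedded_C1_submanifold T1_space"
  unfolding embedded_C1_submanifold_def
proof (intro exI conjI ballI)
  \<comment> \<open>One global chart serves at every point, with \<open>octant\<close> and the whole
    space as the two open sets and this plane as the model space.\<close>
  let ?S = "{x :: real ^ 3. (\<Sum>i\<in>UNIV. x $ i) = 0}"
  show "subspace ?S"
    by (auto simp: subspace_def sum.distrib simp flip: sum_distrib_left)
  show "open octant" "open (UNIV :: (real ^ 3) set)"
    by (auto simp: open_octant)
  show "p \<in> octant" if "p \<in> T1_space" for p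
    using that by (simp add: T1_space_iff)
  show "C1_map_on octant chart"
    using has_derivative_chart continuous_on_dchart by (rule C1_map_onI)
  show "C1_map_on UNIV unchart"
    using has_derivative_unchart continuous_on_dunchart by (rule C1_map_onI)
  have "continuous_on octant chart"
    by (auto intro!: continuous_at_imp_continuous_on
        intro: has_derivative_continuous has_derivative_chart)
  then show "homeomorphism octant UNIV chart unchart"
    by (intro homeomorphismI)
      (auto simp: unchart_octant unchart_chart chart_unchart continuous_on_unchart)
  show "chart ` (T1_space \<inter> octant) = ?S \<inter> UNIV"
  proof (intro equalityI subsetI)
    fix x assume "x \<in> ?S \<inter> UNIV"
    then show "x \<in> chart ` (T1_space \<inter> octant)"
      by (intro image_eqI[of _ _ "unchart x"]) (auto simp: chart_unchart unchart_T1 unchart_octant)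
  qed (auto simp: T1_space_iff)
qed

text \<open>Straight chart lines serve twice: as curves realising tangent vectors and as shortest
  curves.\<close>

lemma unchart_line_has_vector_derivative:
  "((\<lambda>t. unchart (x + t *\<^sub>R u)) has_vector_derivative dunchart (x + t *\<^sub>R u) u) (at t within S)"
proof -
  have "((\<lambda>t. x + t *\<^sub>R u) has_vector_derivative u) (at t within S)"
    by (auto intro!: derivative_eq_intros)
  from vector_derivative_diff_chain_within[OF this has_derivative_at_withinI[OF has_derivative_unchart]]
  show ?thesis
    by (simp add: o_def)
qed

lemma continuous_on_unchart_line_derivative:
  "continuous_on S (\<lambda>t::real. dunchart (x + t *\<^sub>R u) u)"
  by (rule continuous_on_compose2[OF continuous_on_dunchart[of UNIV]]) (auto intro!: continuous_intros)

text \<open>The tangent space is the kernel of the derivative of the coordinate sum of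
  \<open>chart\<close>. That sum vanishes along every curve in \<open>T1_space\<close>, which gives
  one inclusion; the other needs a curve for each kernel vector.\<close>

lemma tangent_space_T1:
  assumes "A \<in> T1_space"
  shows "tangent_space T1_space A = {v. (\<Sum>i\<in>UNIV. dchart A v $ i) = 0}"
proof (intro equalityI subsetI)
  have A: "A \<in> octant" "(\<Sum>i\<in>UNIV. chart A $ i) = 0"
    using assms by (auto simp: T1_space_iff)
  {
    fix v assume "v \<in> tangent_space T1_space A"
    then obtain c e where c: "0 < e" "c ` {-e<..<e} \<subseteq> T1_space" "c 0 = A"
      and deriv: "(c has_vector_derivative v) (at (0::real))"
      by (auto simp: tangent_space_def)
    have "(chart \<circ> c has_vector_derivative dchart A v) (at 0)"
      using deriv c A has_derivative_chart
      by (metis has_derivative_at_withinI vector_derivative_diff_chain_within)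
    then have "((\<lambda>t. \<Sum>i\<in>UNIV. chart (c t) $ i) has_vector_derivative (\<Sum>i\<in>UNIV. dchart A v $ i)) (at 0)"
      by (intro has_vector_derivative_sum bounded_linear.has_vector_derivative[OF bounded_linear_vec_nth])
        (auto simp: o_def)
    moreover have "((\<lambda>t. \<Sum>i\<in>UNIV. chart (c t) $ i) has_vector_derivative 0) (at 0)"
      by (rule has_vector_derivative_transform_within_open[of "\<lambda>_. 0" _ _ "{-e<..<e}"])
        (use c in \<open>auto simp: T1_space_iff image_subset_iff\<close>)
    ultimately show "v \<in> {v. (\<Sum>i\<in>UNIV. dchart A v $ i) = 0}"
      using vector_derivative_unique_at by blast
  next
    fix v assume "v \<in> {v. (\<Sum>i\<in>UNIV. dchart A v $ i) = 0}"
    then have v: "(\<Sum>i\<in>UNIV. dchart A v $ i) = 0" by simp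
    \<comment> \<open>The chart line in direction \<open>dchart A v\<close> stays in the plane of
      coordinate sum 0 because \<open>v\<close> lies in the kernel, and
      \<open>dunchart_dchart\<close> identifies its velocity at 0 as \<open>v\<close>.\<close>
    define c where "c = (\<lambda>t::real. unchart (chart A + t *\<^sub>R dchart A v))"
    have deriv: "(c has_vector_derivative dunchart (chart A + t *\<^sub>R dchart A v) (dchart A v)) (at t)" for t
      unfolding c_def by (rule unchart_line_has_vector_derivative)
    have "c C1_differentiable_on {-1<..<1}"
      unfolding C1_differentiable_on_def
      using deriv continuous_on_unchart_line_derivative by (intro exI conjI ballI)
    moreover have "c ` {-1<..<1} \<subseteq> T1_space"
      using A v by (auto simp: c_def sum.distrib simp flip: sum_distrib_left intro!: unchart_T1)
    moreover have "c 0 = A"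
      using A by (simp add: c_def unchart_chart)
    moreover have "(c has_vector_derivative v) (at 0)"
      using deriv[of 0] A by (simp add: dunchart_dchart)
    ultimately show "v \<in> tangent_space T1_space A"
      unfolding tangent_space_def by (intro CollectI exI[of _ c] exI[of _ 1]) auto
  }
qed

section \<open>The Finsler structure\<close>

lemma continuous_on_F_T1: "continuous_on (octant \<times> UNIV) F_T1"
proof -
  have "F_T1 = (\<lambda>p. max (snd p $ 1 / fst p $ 1) (max (snd p $ 2 / fst p $ 2) (snd p $ 3 / fst p $ 3)))"
    by (auto simp: F_T1_def)
  moreover have "continuous_on (octant \<times> UNIV) \<dots>"
    by (intro continuous_intros) (auto simp: octant_nonzero)
  ultimately show ?thesis
    by (simp only:)
qed

text \<open>Homogeneity and convexity are those of a maximum of linear functionals. Definiteness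
  uses tangency: the ratios \<open>v $ i / A $ i\<close> satisfy a linear relation with strictly
  positive weights, so they cannot all be nonpositive unless they all vanish.\<close>

lemma minkowski_norm_F_T1:
  assumes "A \<in> T1_space"
  shows "minkowski_norm_on (tangent_space T1_space A) (\<lambda>v. F_T1 (A, v))"
proof -
  have oct: "A \<in> octant"
    using assms by (simp add: T1_space_iff)
  \<comment> \<open>Writing each \<open>v $ i\<close> as \<open>(v $ i / A $ i) * A $ i\<close> in
    the coordinate sum of \<open>dchart A v\<close> gives these weights on the ratios.\<close>
  define a where "a i = 1 + A $ i / (\<Sum>j\<in>UNIV. A $ j)" for i
  have A: "0 < A $ i" and a: "0 < a i" for i
    using oct sum_octant_pos[OF oct] by (auto simp: octant_def a_def intro!: add_pos_pos)
  have dchart_sum: "(\<Sum>i\<in>UNIV. dchart A v $ i) = (\<Sum>i\<in>UNIV. v $ i / A $ i * a i)" for v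
  proof -
    have "v $ i / A $ i * a i = v $ i / A $ i + v $ i / (\<Sum>j\<in>UNIV. A $ j)" for i
      using A[of i] by (simp add: a_def distrib_left)
    then show ?thesis
      by (simp add: dchart_def sum.distrib flip: sum_divide_distrib)
  qed
  define V where "V = {v :: real ^ 3. (\<Sum>i\<in>UNIV. v $ i / A $ i * a i) = 0}"
  have tangent: "tangent_space T1_space A = V"
    using assms by (simp add: tangent_space_T1 dchart_sum V_def)
  have ge: "v $ i / A $ i \<le> F_T1 (A, v)" for v i
    by (simp add: F_T1_altdef)
  have attained: "\<exists>i. F_T1 (A, v) = v $ i / A $ i" for v
    using Max_in[of "range (\<lambda>i. v $ i / A $ i)"] by (auto simp only: F_T1_altdef finite_code finite_imageI)
  have le0: "v = 0" if "v \<in> V" "F_T1 (A, v) \<le> 0" for v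
  proof -
    have le: "v $ i / A $ i \<le> 0" for i
      using ge[of v i] that(2) by linarith
    then have "- (v $ i / A $ i * a i) \<ge> 0" for i
      using mult_nonpos_nonneg[OF le less_imp_le[OF a]] by (simp only: neg_0_le_iff_le)
    moreover have "(\<Sum>i\<in>UNIV. - (v $ i / A $ i * a i)) = 0"
      using that(1) by (simp add: V_def sum_negf)
    ultimately have "- (v $ i / A $ i * a i) = 0" for i
      by (metis (no_types, lifting) finite_class.finite_UNIV sum_nonneg_0 UNIV_I)
    then have "v $ i = 0" for i
      using A[of i] a[of i] by (metis divide_eq_0_iff less_irrefl mult_eq_0_iff neg_equal_0_iff_equal)
    then show "v = 0"
      by (simp add: vec_eq_iff)
  qed
  have F0: "F_T1 (A, 0) = 0"
    by (simp add: F_T1_def)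
  show ?thesis
    unfolding minkowski_norm_on_def tangent
  proof (intro conjI ballI allI impI)
    show "subspace V"
      by (auto simp: V_def subspace_def sum.distrib add_divide_distrib distrib_right mult.assoc
          simp flip: sum_distrib_left times_divide_eq_right)
    \<comment> \<open>A negative value would force \<open>v = 0\<close> by \<open>le0\<close>, but
      the value there is 0.\<close>
    show "0 \<le> F_T1 (A, v)" if "v \<in> V" for v
      using le0[OF that] F0 by fastforce
    show "F_T1 (A, v) = 0 \<longleftrightarrow> v = 0" if "v \<in> V" for v
      using le0[OF that] F0 by auto
    show "F_T1 (A, t *\<^sub>R v) = t * F_T1 (A, v)" if "0 < t" for t v
    proof (rule antisym)
      obtain i where "F_T1 (A, t *\<^sub>R v) = (t *\<^sub>R v) $ i / A $ i"
        using attained by blast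
      then show "F_T1 (A, t *\<^sub>R v) \<le> t * F_T1 (A, v)"
        using ge[of v i] that by (simp flip: times_divide_eq_right)
      obtain j where "F_T1 (A, v) = v $ j / A $ j"
        using attained by blast
      then show "t * F_T1 (A, v) \<le> F_T1 (A, t *\<^sub>R v)"
        using ge[of "t *\<^sub>R v" j] by simp
    qed
    show "F_T1 (A, t *\<^sub>R v + (1 - t) *\<^sub>R w) \<le> t * F_T1 (A, v) + (1 - t) * F_T1 (A, w)"
      if t: "t \<in> {0..1}" for t v w
    proof -
      obtain i where "F_T1 (A, t *\<^sub>R v + (1 - t) *\<^sub>R w) = t * (v $ i / A $ i) + (1 - t) * (w $ i / A $ i)"
        using attained[of "t *\<^sub>R v + (1 - t) *\<^sub>R w"] by (auto simp: add_divide_distrib)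
      moreover have "t * (v $ i / A $ i) \<le> t * F_T1 (A, v)"
        using ge t by (intro mult_left_mono) auto
      moreover have "(1 - t) * (w $ i / A $ i) \<le> (1 - t) * F_T1 (A, w)"
        using ge t by (intro mult_left_mono) auto
      ultimately show ?thesis
        by linarith
    qed
  qed
qed

lemma finsler_T1: "finsler_structure_on T1_space F_T1"
  unfolding finsler_structure_on_def
proof (intro conjI ballI)
  show "continuous_on (tangent_bundle T1_space) F_T1"
    using continuous_on_F_T1
    by (rule continuous_on_subset) (auto simp: tangent_bundle_def T1_space_iff)
qed (auto simp: embedded_T1 minkowski_norm_F_T1)

section \<open>The lower bound for lengths\<close>

lemma eta_altdef:
  assumes "X \<in> octant" "Y \<in> octant"
  shows "eta X Y = Max (range (\<lambda>i. ln (Y $ i) - ln (X $ i)))"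
proof -
  have pos: "0 < Y $ i / X $ i" for i
    using assms by (simp add: octant_def)
  have ln_max: "ln (max a b) = max (ln a) (ln b)" if "0 < a" "0 < b" for a b :: real
    using that by (simp add: max_def)
  have "eta X Y = Max (range (\<lambda>i. ln (Y $ i / X $ i)))"
    using pos unfolding eta_def Max_range_3 by (simp add: ln_max max_less_iff_conj less_max_iff_disj)
  also have "\<dots> = Max (range (\<lambda>i. ln (Y $ i) - ln (X $ i)))"
    using assms by (simp add: octant_nonzero ln_div)
  finally show ?thesis .
qed

text \<open>The logarithm of each coordinate of \<open>c\<close> has derivative
  \<open>D t $ i / c t $ i\<close>, which is at most \<open>F_T1 (c t, D t)\<close>; integrating
  gives the bound. The index \<open>i\<close> is kept free so that bounds for the same coordinate
  can be added over consecutive pieces.\<close>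

lemma piece_length:
  fixes c :: "real \<Rightarrow> real ^ 3"
  assumes "0 \<le> a" "a < b" "b \<le> 1" "c ` {0..1} \<subseteq> T1_space"
    and D: "continuous_on {a..b} D"
    and deriv: "\<And>t. t \<in> {a..b} \<Longrightarrow> (c has_vector_derivative D t) (at t within {a..b})"
  defines "L \<equiv> \<lambda>t. F_T1 (c t, vector_derivative c (at t within {0..1}))"
  shows "L integrable_on {a..b}"
    and "ln (c b $ i) - ln (c a $ i) \<le> integral {a..b} L"
proof -
  have oct: "c t \<in> octant" if "t \<in> {a..b}" for t
    using assms that by (auto simp: T1_space_iff image_subset_iff)
  have "continuous_on {a..b} c"
    unfolding continuous_on_eq_continuous_within
    using deriv by (blast intro: has_vector_derivative_continuous)
  then have "continuous_on {a..b} (\<lambda>t. F_T1 (c t, D t))"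
    by (intro continuous_on_compose2[OF continuous_on_F_T1] continuous_intros D) (auto simp: oct)
  then have int: "(\<lambda>t. F_T1 (c t, D t)) integrable_on {a..b}"
    by (rule integrable_continuous_interval)
  \<comment> \<open>At \<open>a\<close> and \<open>b\<close> the curve may have a corner, where
    \<open>D\<close> is only a one-sided velocity. Agreement off these two points suffices for the
    integrals.\<close>
  have L: "L t = F_T1 (c t, D t)" if "t \<in> {a..b} - {a, b}" for t
  proof -
    have "t \<in> {a<..<b}"
      using that by auto
    then have "(c has_vector_derivative D t) (at t)"
      using deriv[of t] that by (auto simp: at_within_Icc_at)
    then have "vector_derivative c (at t within {0..1}) = D t"
      using that assms
      by (intro vector_derivative_within_closed_interval) (auto intro: has_vector_derivative_at_within)
    then show ?thesis
      by (simp add: L_def)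
  qed
  show "L integrable_on {a..b}"
    by (rule integrable_spike_finite[OF _ L int, of "{a, b}"]) auto
  have "integral {a..b} L = integral {a..b} (\<lambda>t. F_T1 (c t, D t))"
    by (rule integral_spike[of "{a, b}"]) (auto simp: L)
  moreover have "((\<lambda>t. D t $ i / c t $ i) has_integral ln (c b $ i) - ln (c a $ i)) {a..b}"
  proof (rule fundamental_theorem_of_calculus)
    fix t assume t: "t \<in> {a..b}"
    have "((\<lambda>t. c t $ i) has_real_derivative D t $ i) (at t within {a..b})"
      using bounded_linear.has_vector_derivative[OF bounded_linear_vec_nth deriv[OF t]]
      by (simp add: has_real_derivative_iff_has_vector_derivative)
    then have "((\<lambda>t. ln (c t $ i)) has_real_derivative D t $ i / c t $ i) (at t within {a..b})"
      using oct[OF t] by (auto simp: octant_def intro!: derivative_eq_intros)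
    then show "((\<lambda>t. ln (c t $ i)) has_vector_derivative D t $ i / c t $ i) (at t within {a..b})"
      by (simp add: has_real_derivative_iff_has_vector_derivative)
  qed (use assms in simp)
  then have "ln (c b $ i) - ln (c a $ i) \<le> integral {a..b} (\<lambda>t. F_T1 (c t, D t))"
    by (rule has_integral_le[OF _ integrable_integral[OF int]]) (simp add: F_T1_altdef)
  ultimately show "ln (c b $ i) - ln (c a $ i) \<le> integral {a..b} L"
    by simp
qed

lemma eta_le_finsler_length:
  assumes "X \<in> T1_space" "Y \<in> T1_space" "c \<in> curves_between T1_space X Y"
  shows "eta X Y \<le> finsler_length F_T1 c"
proof -
  define L where "L = (\<lambda>t. F_T1 (c t, vector_derivative c (at t within {0..1})))"
  have c: "c ` {0..1} \<subseteq> T1_space" "c 0 = X" "c 1 = Y"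
    using assms by (auto simp: curves_between_def)
  have "piecewise_C1_curve c"
    using assms(3) by (simp add: curves_between_def)
  then obtain n p where p: "p 0 = 0" "p n = (1::real)" "\<And>i. i < n \<Longrightarrow> p i < p (Suc i)"
    and D: "\<And>i. i < n \<Longrightarrow> \<exists>D. continuous_on {p i..p (Suc i)} D \<and>
        (\<forall>t\<in>{p i..p (Suc i)}. (c has_vector_derivative D t) (at t within {p i..p (Suc i)}))"
    unfolding piecewise_C1_curve_def by metis
  \<comment> \<open>Monotone breakpoints keep every piece inside \<open>{0..1}\<close>, as
    \<open>piece_length\<close> demands.\<close>
  have mono: "p i \<le> p j" if "i \<le> j" "j \<le> n" for i j
    using that(1,2)
    by (induction rule: dec_induct)
      (use p(3) in \<open>auto intro: order_trans less_imp_le simp: Suc_le_eq\<close>)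
  \<comment> \<open>For each fixed \<open>i\<close> the logarithmic increments telescope over the
    pieces; the maximum over \<open>i\<close> is taken only after the last piece. Integrability is
    carried along because splitting the integral requires it.\<close>
  have "L integrable_on {0..p k} \<and> (\<forall>i. ln (c (p k) $ i) - ln (X $ i) \<le> integral {0..p k} L)"
    if "k \<le> n" for k
    using that
  proof (induction k)
    case 0
    then show ?case
      using p c integrable_on_refl[of L 0] by simp
  next
    case (Suc k)
    obtain D where D: "continuous_on {p k..p (Suc k)} D"
        "\<And>t. t \<in> {p k..p (Suc k)} \<Longrightarrow> (c has_vector_derivative D t) (at t within {p k..p (Suc k)})"
      using D[of k] Suc.prems by auto
    have bounds: "0 \<le> p k" "p k < p (Suc k)" "p (Suc k) \<le> 1"
      using mono[of 0 k] mono[of "Suc k" n] p Suc.prems by auto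
    note piece = piece_length[OF bounds c(1) D, folded L_def]
    have IH: "L integrable_on {0..p k}" "\<And>i. ln (c (p k) $ i) - ln (X $ i) \<le> integral {0..p k} L"
      using Suc by auto
    have int: "L integrable_on {0..p (Suc k)}"
      using Henstock_Kurzweil_Integration.integrable_combine[OF _ _ IH(1) piece(1)] bounds by simp
    then have "integral {0..p (Suc k)} L = integral {0..p k} L + integral {p k..p (Suc k)} L"
      using Henstock_Kurzweil_Integration.integral_combine[OF _ _ int, of "p k"] bounds by simp
    moreover have "ln (c (p (Suc k)) $ i) - ln (c (p k) $ i) \<le> integral {p k..p (Suc k)} L" for i
      by (rule piece(2))
    ultimately show ?case
      using int IH(2) by (smt (verit))
  qed
  from this[of n] have "ln (Y $ i) - ln (X $ i) \<le> finsler_length F_T1 c" for i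
    using p c by (simp add: finsler_length_def L_def)
  then show ?thesis
    using assms by (auto simp: eta_altdef T1_space_iff)
qed

section \<open>Chart segments as shortest curves\<close>

lemma geodesic_exists:
  assumes "X \<in> T1_space" "Y \<in> T1_space"
  shows "\<exists>c\<in>curves_between T1_space X Y. finsler_length F_T1 c = eta X Y"
proof -
  have X: "X \<in> octant" "(\<Sum>i\<in>UNIV. chart X $ i) = 0" and Y: "Y \<in> octant" "(\<Sum>i\<in>UNIV. chart Y $ i) = 0"
    using assms by (auto simp: T1_space_iff)
  define u where "u = chart Y - chart X"
  define x where "x = (\<lambda>t::real. chart X + t *\<^sub>R u)"
  define c where "c = (\<lambda>t. unchart (x t))"
  \<comment> \<open>This is the correction subtracted by \<open>unchart\<close> along the segment,
    so \<open>ln (c t $ i) = x t $ i - h t\<close> for every \<open>i\<close>; \<open>h'\<close> is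
    its derivative.\<close>
  define h where "h = (\<lambda>t. ln (\<Sum>j\<in>UNIV. exp (x t $ j)) / 4)"
  define h' where "h' = (\<lambda>t. (\<Sum>j\<in>UNIV. exp (x t $ j) * u $ j) / (4 * (\<Sum>j\<in>UNIV. exp (x t $ j))))"
  have deriv: "(c has_vector_derivative dunchart (x t) u) (at t within S)" for t S
    unfolding c_def x_def by (rule unchart_line_has_vector_derivative)
  have cont: "continuous_on S (\<lambda>t. dunchart (x t) u)" for S
    unfolding x_def by (rule continuous_on_unchart_line_derivative)
  have ends: "c 0 = X" "c 1 = Y"
    using X Y by (auto simp: c_def x_def u_def unchart_chart)
  have "(\<Sum>i\<in>UNIV. x t $ i) = 0" for t
    using X Y by (simp add: x_def u_def sum.distrib sum_subtractf flip: sum_distrib_left)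
  then have "c ` {0..1} \<subseteq> T1_space"
    by (auto simp: c_def unchart_T1)
  \<comment> \<open>A single piece: the breakpoints are \<open>real 0 = 0\<close> and
    \<open>real 1 = 1\<close>.\<close>
  moreover have "piecewise_C1_curve c"
    unfolding piecewise_C1_curve_def using deriv cont
    by (intro exI[of _ 1] exI[of _ real]) auto
  ultimately have curve: "c \<in> curves_between T1_space X Y"
    using ends by (simp add: curves_between_def)
  have c_pos: "0 < c t $ i" for t i
    using unchart_octant by (simp add: c_def octant_def)
  \<comment> \<open>All logarithmic derivatives are \<open>u $ i\<close> shifted by the same
    \<open>- h' t\<close>, so the maximum is attained at a fixed index and can be pulled out of the
    integral.\<close>
  have speed: "F_T1 (c t, vector_derivative c (at t within {0..1})) = Max (range (($) u)) - h' t"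
    if "t \<in> {0..1}" for t
  proof -
    have "vector_derivative c (at t within {0..1}) = dunchart (x t) u"
      using that deriv by (intro vector_derivative_within_closed_interval) auto
    moreover have "dunchart (x t) u $ i / c t $ i = u $ i + - h' t" for i
      using c_pos[of t i] by (simp add: dunchart_def c_def h'_def)
    ultimately show ?thesis
      unfolding F_T1_altdef using Max_range_add_const[of "($) u" "- h' t"] by simp
  qed
  have "(h has_real_derivative h' t) (at t within {0..1})" for t
    unfolding h_def h'_def x_def using sum_exp_pos[of "chart X + t *\<^sub>R u"]
    by (auto intro!: derivative_eq_intros simp: divide_simps mult_ac)
  then have "(h' has_integral h 1 - h 0) {0..1}"
    by (intro fundamental_theorem_of_calculus) (auto simp: has_real_derivative_iff_has_vector_derivative)
  then have "((\<lambda>t. Max (range (($) u)) - h' t) has_integral Max (range (($) u)) - (h 1 - h 0)) {0..1}"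
    using has_integral_diff[OF has_integral_const_real[of "Max (range (($) u))" 0 1]] by simp
  then have "finsler_length F_T1 c = Max (range (($) u)) - (h 1 - h 0)"
    unfolding finsler_length_def
    by (subst integral_cong[OF speed]) (auto intro: integral_unique)
  \<comment> \<open>Moving the constant back inside the maximum turns each entry into the
    logarithmic increment of one coordinate from \<open>X\<close> to \<open>Y\<close>.\<close>
  also have "\<dots> = Max (range (\<lambda>i. u $ i + (h 0 - h 1)))"
    using Max_range_add_const[of "($) u" "h 0 - h 1"] by simp
  also have "(\<lambda>i. u $ i + (h 0 - h 1)) = (\<lambda>i. ln (Y $ i) - ln (X $ i))"
  proof
    fix i
    have "ln (c t $ i) = x t $ i - h t" for t
      by (simp add: c_def unchart_def h_def)
    from this[of 0] this[of 1] show "u $ i + (h 0 - h 1) = ln (Y $ i) - ln (X $ i)"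
      by (simp add: ends) (simp add: x_def)
  qed
  finally show ?thesis
    using curve X Y by (auto simp: eta_altdef)
qed

theorem theorem3p11:
  shows "finsler_structure_on T1_space F_T1 \<and> induced_by_finsler T1_space F_T1 eta"
proof
  show "finsler_structure_on T1_space F_T1"
    by (rule finsler_T1)
  show "induced_by_finsler T1_space F_T1 eta"
    unfolding induced_by_finsler_def
  proof (intro ballI antisym)
    fix X Y assume XY: "X \<in> T1_space" "Y \<in> T1_space"
    show "ereal (eta X Y) \<le> (INF c\<in>curves_between T1_space X Y. ereal (finsler_length F_T1 c))"
      using XY by (intro INF_greatest) (simp add: eta_le_finsler_length)
    \<comment> \<open>The infimum is attained, by the chart segment from \<open>X\<close> to
      \<open>Y\<close>.\<close>
    show "(INF c\<in>curves_between T1_space X Y. ereal (finsler_length F_T1 c)) \<le> ereal (eta X Y)"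
      using geodesic_exists[OF XY] by (auto intro: INF_lower2)
  qed
qed

end
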